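(* Let $d\in\mathbb{N}$ with $d\ge2$ and let $(p,q)\in[0,1]^2$ with $0<p+q<1$. The probabilistic tree automaton $B_{p,q}$ on the rooted $d$-regular tree $T_d$ is ergodic if and only if $$(1-p-q)(1-q)^{d-1}\le (d+1)^{d-1}d^{-d}.$$
   Context: $T_d$ is the rooted tree, with root $\phi$, in which every vertex has precisely $d$ children. Probabilistic tree automaton (PTA): a PTA $A$ on $T_d$ consists of a finite alphabet $\mathcal{S}$ of states and a stochastic matrix $\vartheta_A$ of size $|\mathcal{S}|^d\times|\mathcal{S}|$: if the children $u_1,\dots,u_d$ of a vertex $u$ have states $a_1,\dots,a_d$, then $u$ gets state $b$ with probability $\vartheta_A((a_1,\dots,a_d),b)$. Let $L_n$ be the set of vertices in generation $n$ of $T_d$ ($L_0=\{\phi\}$). Conditionally on the states of the vertices in $L_{n+1}$, the states of the vertices in $L_n$ produced by $A$ are independent. For a deterministic boundary configuration $\sigma:L_n\to\mathcal{S}$, let $\mu_A(\sigma)$ denote the law of the random state of $\phi$ obtained by starting from $\sigma$ on $L_n$ and iteratively applying $A$ to generations $n-1,n-2,\dots,0$. The PTA $A$ is ergodic if $$\limsup_{n\to\infty}\ \sup_{\sigma,\tau:L_n\to\mathcal{S}}\|\mu_A(\sigma)-\mu_A(\tau)\|_{\mathrm{TV}}=0,$$ where $\|\cdot\|_{\mathrm{TV}}$ is total variation distance. The PTA $B_{p,q}$ has alphabet $\mathcal{S}=\{W,L,D\}$ and, for $a_1,\dots,a_d\in\mathcal{S}$ with $i=|\{k:a_k=L\}|$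 and $j=|\{k:a_k=D\}|$, $$\vartheta_{B_{p,q}}((a_1,\dots,a_d),b)=\begin{cases}1-p^{i}(1-q)^{d-i}& b=W,\\ p^{i}(1-q)^{d-i}-p^{i+j}(1-q)^{d-i-j}& b=D,\\ p^{i+j}(1-q)^{d-i-j}& b=L,\end{cases}$$ with $0^0=1$. *)

theory Defs
  imports "HOL-Probability.Probability"
begin

text \<open>Vertices of the rooted \<open>d\<close>-regular tree are words over \<open>{0..<d}\<close>: the root is \<open>[]\<close>
  and the children of \<open>u\<close> are \<open>u @ [0], \<dots>, u @ [d - 1]\<close>.\<close>

definition level :: "nat \<Rightarrow> nat \<Rightarrow> nat list set" where
  "level d n = {u. length u = n \<and> set u \<subseteq> {..<d}}"

lemma finite_level: "finite (level d n)"
  using finite_lists_length_eq[of "{..<d}" n] by (simp add: level_def conj_commute)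

definition child_states :: "nat \<Rightarrow> (nat list \<Rightarrow> 's) \<Rightarrow> nat list \<Rightarrow> 's list" where
  "child_states d \<sigma> u = map (\<lambda>k. \<sigma> (u @ [k])) [0..<d]"

text \<open>Rows of the matrix are indexed by the lists of length \<open>d\<close>; values at other lists play
  no role.\<close>

definition stochastic :: "nat \<Rightarrow> ('s::finite list \<Rightarrow> 's \<Rightarrow> real) \<Rightarrow> bool" where
  "stochastic d \<theta> \<longleftrightarrow>
     (\<forall>as. length as = d \<longrightarrow> (\<forall>b. 0 \<le> \<theta> as b) \<and> (\<Sum>b\<in>UNIV. \<theta> as b) = 1)"

text \<open>\<open>pta_step d \<theta> n \<sigma>\<close> is the law of the configuration on generation \<open>n\<close> given the
  configuration \<open>\<sigma>\<close> on generation \<open>n + 1\<close>. The product takes the value \<open>undefined\<close> outside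
  generation \<open>n\<close>, so it lives on \<open>level d n \<rightarrow>\<^sub>E UNIV\<close>. For a stochastic \<open>\<theta>\<close>,
  \<open>embed_pmf (\<theta> as)\<close> has exactly the row \<open>\<theta> as\<close> as its mass function, see
  \<open>pmf_embed_stochastic\<close>.\<close>

definition pta_step ::
    "nat \<Rightarrow> ('s::finite list \<Rightarrow> 's \<Rightarrow> real) \<Rightarrow> nat \<Rightarrow> (nat list \<Rightarrow> 's) \<Rightarrow> (nat list \<Rightarrow> 's) pmf" where
  "pta_step d \<theta> n \<sigma> =
     Pi_pmf (level d n) undefined (\<lambda>u. embed_pmf (\<theta> (child_states d \<sigma> u)))"

primrec pta_law ::
    "nat \<Rightarrow> ('s::finite list \<Rightarrow> 's \<Rightarrow> real) \<Rightarrow> nat \<Rightarrow> (nat list \<Rightarrow> 's) \<Rightarrow> 's pmf" where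
  "pta_law d \<theta> 0 \<sigma> = return_pmf (\<sigma> [])"
| "pta_law d \<theta> (Suc n) \<sigma> = bind_pmf (pta_step d \<theta> n \<sigma>) (pta_law d \<theta> n)"

definition tv_dist :: "'s pmf \<Rightarrow> 's pmf \<Rightarrow> real" where
  "tv_dist P Q = (SUP E. \<bar>measure_pmf.prob P E - measure_pmf.prob Q E\<bar>)"

definition pta_ergodic :: "nat \<Rightarrow> ('s::finite list \<Rightarrow> 's \<Rightarrow> real) \<Rightarrow> bool" where
  "pta_ergodic d \<theta> \<longleftrightarrow>
     limsup (\<lambda>n. SUP \<sigma>\<in>level d n \<rightarrow>\<^sub>E UNIV. SUP \<tau>\<in>level d n \<rightarrow>\<^sub>E UNIV.
       ereal (tv_dist (pta_law d \<theta> n \<sigma>) (pta_law d \<theta> n \<tau>))) = 0"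

datatype state = W | L | D

lemma UNIV_state: "UNIV = {W, L, D}"
  by (auto intro: state.exhaust)

instance state :: finite
  by standard (simp add: UNIV_state)

definition B_matrix :: "nat \<Rightarrow> real \<Rightarrow> real \<Rightarrow> state list \<Rightarrow> state \<Rightarrow> real" where
  "B_matrix d p q as b =
     (let i = card {k. k < d \<and> as ! k = L}; j = card {k. k < d \<and> as ! k = D} in
      case b of
        W \<Rightarrow> 1 - p ^ i * (1 - q) ^ (d - i)
      | D \<Rightarrow> p ^ i * (1 - q) ^ (d - i) - p ^ (i + j) * (1 - q) ^ (d - i - j)
      | L \<Rightarrow> p ^ (i + j) * (1 - q) ^ (d - i - j))"

lemma pmf_embed_stochastic:
  assumes "stochastic d \<theta>" "length as = d"
  shows "pmf (embed_pmf (\<theta> as)) b = \<theta> as b"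
proof (rule pmf_embed_pmf)
  show nonneg: "0 \<le> \<theta> as x" for x
    using assms by (auto simp: stochastic_def)
  show "(\<integral>\<^sup>+ x. ennreal (\<theta> as x) \<partial>count_space UNIV) = 1"
    using assms by (simp add: nn_integral_count_space_finite sum_ennreal nonneg stochastic_def)
qed

lemma stochastic_B_matrix:
  assumes "p \<in> {0..1}" "q \<in> {0..1}" "p + q < 1"
  shows "stochastic d (B_matrix d p q)"
  unfolding stochastic_def
proof (intro allI impI conjI)
  fix as b
  define i where "i = card {k. k < d \<and> as ! k = L}"
  define j where "j = card {k. k < d \<and> as ! k = D}"
  have "i + j = card ({k. k < d \<and> as ! k = L} \<union> {k. k < d \<and> as ! k = D})"
    unfolding i_def j_def by (subst card_Un_disjoint) auto
  also have "\<dots> \<le> card {..<d}"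
    by (intro card_mono) auto
  finally have ij: "i + j \<le> d" by simp
  have "p ^ j * (p ^ i * (1 - q) ^ (d - i - j)) \<le> (1 - q) ^ j * (p ^ i * (1 - q) ^ (d - i - j))"
    using assms by (intro mult_right_mono power_mono) auto
  moreover have "(1 - q) ^ (d - i) = (1 - q) ^ j * (1 - q) ^ (d - i - j)"
    using ij by (simp flip: power_add)
  ultimately have "p ^ (i + j) * (1 - q) ^ (d - i - j) \<le> p ^ i * (1 - q) ^ (d - i)"
    by (simp add: power_add mult_ac)
  moreover have "p ^ i * (1 - q) ^ (d - i) \<le> 1"
    using assms by (intro mult_le_one power_le_one) auto
  moreover have "0 \<le> p ^ (i + j) * (1 - q) ^ (d - i - j)"
    using assms by simp
  ultimately show "0 \<le> B_matrix d p q as b"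
    unfolding B_matrix_def Let_def i_def [symmetric] j_def [symmetric]
    by (cases b) auto
next
  fix as
  show "(\<Sum>b\<in>UNIV. B_matrix d p q as b) = 1"
    by (simp add: UNIV_state B_matrix_def Let_def)
qed

end

theory Submission
  imports Defs
begin

text \<open>A state is coded by the two bits ``not a win'' and ``a loss''. Each bit of a vertex is a
  product, over the children, of factors affine in the opposite bit. Since generations consist of
  independent states, the probabilities of the two root events follow the
  recursion \<open>t \<mapsto> \<Prod>\<^sub>k (1 - q - (1 - p - q) t\<^sub>k)\<close>, and ergodicity means that the iterates of
  \<open>g t = (1 - q - (1 - p - q) t) ^ d\<close> started at \<open>0\<close> and at \<open>1\<close> merge. They do not merge if the
  fixed point is repelling. If they do not merge, \<open>g\<close> has a proper 2-cycle \<open>{a ^ d, b ^ d}\<close>, and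
  eliminating the parameters gives
  \<open>(1 - p - q) (1 - q) ^ (d - 1) = S\<^sub>d\<^sub>+\<^sub>1 ^ (d - 1) / S\<^sub>d ^ d\<close> with
  \<open>S\<^sub>k = (a ^ k - b ^ k) / (a - b)\<close>, which is larger than the threshold because the moments
  \<open>S\<^sub>k / k\<close> of the uniform law on \<open>[b, a]\<close> have strictly increasing power means.\<close>

section \<open>Power means of the uniform law\<close>

text \<open>The mean of \<open>x ^ k\<close> over \<open>[b, a]\<close> in closed form. Relative to
  the quotients \<open>S\<close> above the index is shifted: this is \<open>S\<close> at
  \<open>k + 1\<close>, divided by \<open>k + 1\<close>.\<close>

definition unif_moment :: "real \<Rightarrow> real \<Rightarrow> nat \<Rightarrow> real" where
  "unif_moment a b k = (a ^ (k + 1) - b ^ (k + 1)) / ((real k + 1) * (a - b))"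

lemma unif_moment_pos:
  assumes "0 \<le> b" "b < a"
  shows "0 < unif_moment a b k"
proof -
  have "b ^ (k + 1) < a ^ (k + 1)"
    using assms by (intro power_strict_mono) auto
  thus ?thesis using assms by (auto simp: unif_moment_def intro!: divide_pos_pos mult_pos_pos)
qed

lemma sqrt_power_square:
  fixes a b :: real
  assumes "0 \<le> a" "0 \<le> b"
  shows "(sqrt (a * b) ^ k) ^ 2 = a ^ k * b ^ k"
proof -
  have "(sqrt (a * b) ^ k) ^ 2 = (sqrt (a * b) ^ 2) ^ k"
    by (metis power_mult mult.commute)
  thus ?thesis using assms by (simp add: power_mult_distrib)
qed

text \<open>The right side is \<open>a - b\<close> times the sum of the \<open>k + 1\<close>
  monomials \<open>b ^ (k - i) * a ^ i\<close>. The terms \<open>i\<close> and \<open>k - i\<close>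
  have product \<open>(a * b) ^ k\<close>, so AM-GM bounds each such pair; at \<open>i = 0\<close>
  the bound is strict.\<close>

lemma geometric_mean_less_power_sum:
  fixes a b :: real
  assumes "0 \<le> b" "b < a" "1 \<le> k"
  shows "(real k + 1) * sqrt (a * b) ^ k * (a - b) < a ^ (k + 1) - b ^ (k + 1)"
proof -
  define h where "h = sqrt (a * b) ^ k"
  let ?f = "\<lambda>i. b ^ (k - i) * a ^ i"
  have h2: "h ^ 2 = a ^ k * b ^ k"
    unfolding h_def using assms by (intro sqrt_power_square) auto
  have pair_sq: "(?f i + ?f (k - i)) ^ 2 = (2 * h) ^ 2 + (?f i - ?f (k - i)) ^ 2" if "i \<le> k" for i
  proof -
    have "?f i * ?f (k - i) = (b ^ (k - i) * b ^ i) * (a ^ i * a ^ (k - i))"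
      using that by simp
    also have "\<dots> = h ^ 2"
      using that by (simp add: h2 flip: power_add)
    finally show ?thesis by (simp add: power2_eq_square algebra_simps)
  qed
  have nn: "0 \<le> ?f i" for i using assms by simp
  have pair: "2 * h \<le> ?f i + ?f (k - i)" if "i \<le> k" for i
  proof (rule power2_le_imp_le)
    show "(2 * h) ^ 2 \<le> (?f i + ?f (k - i)) ^ 2"
      unfolding pair_sq[OF that] by simp
    show "0 \<le> ?f i + ?f (k - i)"
      by (intro add_nonneg_nonneg nn)
  qed
  have ends: "2 * h < ?f 0 + ?f (k - 0)"
  proof (rule power2_less_imp_less)
    have "b ^ k < a ^ k" using assms by (intro power_strict_mono) auto
    thus "(2 * h) ^ 2 < (?f 0 + ?f (k - 0)) ^ 2"
      unfolding pair_sq[OF le0] by simp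
    show "0 \<le> ?f 0 + ?f (k - 0)"
      by (intro add_nonneg_nonneg nn)
  qed
  \<comment> \<open>Letting \<open>i\<close> run over all indices counts every monomial twice, which
    cancels the factor 2.\<close>
  have "(\<Sum>i<k+1. 2 * h) < (\<Sum>i<k+1. ?f i + ?f (k - i))"
    by (intro sum_strict_mono_ex1) (use pair ends in \<open>auto intro!: bexI[of _ 0]\<close>)
  also have "\<dots> = (\<Sum>i<k+1. ?f i) + (\<Sum>i<k+1. ?f (k - i))"
    by (simp add: sum.distrib)
  also have "(\<Sum>i<k+1. ?f (k - i)) = (\<Sum>i<k+1. ?f i)"
    using sum.nat_diff_reindex[of ?f "k+1"] by simp
  finally have "(real k + 1) * h < (\<Sum>i<k+1. ?f i)"
    by (simp add: algebra_simps)
  hence "(a - b) * ((real k + 1) * h) < (a - b) * (\<Sum>i<k+1. ?f i)"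
    using assms by simp
  also have "\<dots> = a ^ (k + 1) - b ^ (k + 1)"
    using power_diff_sumr2[of a "k+1" b] by simp
  finally show ?thesis by (simp add: h_def mult_ac)
qed

text \<open>Strict Cauchy-Schwarz for consecutive moments, done algebraically: by the identity
  \<open>P\<close> and \<open>K * (K + 2) = (K + 1) ^ 2 - 1\<close> it reduces to the square of the
  preceding inequality.\<close>

lemma unif_moment_log_convex:
  assumes "0 \<le> b" "b < a" "1 \<le> k"
  shows "unif_moment a b k ^ 2 < unif_moment a b (k - 1) * unif_moment a b (k + 1)"
proof -
  define A where "A = a ^ (k + 1) - b ^ (k + 1)"
  define P where "P = (a ^ k - b ^ k) * (a ^ (k + 2) - b ^ (k + 2))"
  define K where "K = real k"
  have K: "K \<ge> 1" using assms by (simp add: K_def)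
  have P: "P = A ^ 2 - a ^ k * b ^ k * (a - b) ^ 2"
    by (simp add: P_def A_def power2_eq_square algebra_simps)
  have cross: "x / v < y / u" if "0 < u" "0 < v" "u * x < v * y" for u v x y :: real
    using that by (simp add: field_simps)
  have "((K + 1) * sqrt (a * b) ^ k * (a - b)) ^ 2 < A ^ 2"
    unfolding A_def K_def using assms
    by (intro power_strict_mono geometric_mean_less_power_sum) auto
  moreover have "(sqrt (a * b) ^ k) ^ 2 = a ^ k * b ^ k"
    using assms by (intro sqrt_power_square) auto
  ultimately have "(K + 1) ^ 2 * (a ^ k * b ^ k * (a - b) ^ 2) < A ^ 2"
    by (simp add: power_mult_distrib mult_ac)
  hence "K * (K + 2) * A ^ 2 < (K + 1) ^ 2 * P"
    unfolding P by (simp add: power2_eq_square algebra_simps)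
  hence "A ^ 2 / (K + 1) ^ 2 < P / (K * (K + 2))"
    using cross[of "K * (K + 2)" "(K + 1) ^ 2"] K by simp
  hence "A ^ 2 / (K + 1) ^ 2 / (a - b) ^ 2 < P / (K * (K + 2)) / (a - b) ^ 2"
    using assms by (intro divide_strict_right_mono) auto
  thus ?thesis
    using assms by (simp add: unif_moment_def A_def P_def K_def of_nat_diff power2_eq_square mult_ac add_ac)
qed

text \<open>Lyapunov's inequality with the roots cleared. Log-convexity at \<open>k + 1\<close>,
  raised to the power \<open>k + 1\<close>, is combined with the induction hypothesis; then the
  common factor \<open>unif_moment a b (k + 1) ^ k\<close> cancels.\<close>

lemma unif_moment_power_mean:
  assumes "0 \<le> b" "b < a" "1 \<le> k"
  shows "unif_moment a b k ^ (k + 1) < unif_moment a b (k + 1) ^ k"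
  using \<open>1 \<le> k\<close>
proof (induction k rule: nat_induct_at_least)
  case base
  have "unif_moment a b 0 = 1" using assms by (simp add: unif_moment_def)
  thus ?case using unif_moment_log_convex[OF assms(1,2), of 1] by (simp add: numeral_2_eq_2)
next
  case (Suc k)
  let ?m = "unif_moment a b"
  note pos = unif_moment_pos[OF assms(1,2)]
  have split: "x ^ (2 * (k + 1)) = x ^ k * x ^ (k + 2)" for x :: real
  proof -
    have "2 * (k + 1) = k + (k + 2)" by simp
    thus ?thesis by (metis power_add)
  qed
  have "?m (k + 1) ^ (2 * (k + 1)) = (?m (k + 1) ^ 2) ^ (k + 1)"
    by (rule power_mult)
  also have "\<dots> < (?m k * ?m (k + 2)) ^ (k + 1)"
    using unif_moment_log_convex[OF assms(1,2), of "k + 1"]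
    by (intro power_strict_mono) auto
  also have "\<dots> = ?m k ^ (k + 1) * ?m (k + 2) ^ (k + 1)"
    by (simp add: power_mult_distrib)
  also have "\<dots> < ?m (k + 1) ^ k * ?m (k + 2) ^ (k + 1)"
    using Suc.IH pos by (intro mult_strict_right_mono) auto
  finally have "?m (k + 1) ^ k * ?m (k + 1) ^ (k + 2) < ?m (k + 1) ^ k * ?m (k + 2) ^ (k + 1)"
    unfolding split .
  thus ?case using pos[of "k + 1"] by simp
qed

text \<open>The two cycle equations are linear in \<open>c\<close> and \<open>s\<close>, so
  \<open>a\<close> and \<open>b\<close> determine both. Written with moments,
  \<open>c * s ^ (d - 1)\<close> is the threshold times a ratio that exceeds 1 by the power mean
  inequality with exponent \<open>d - 1\<close>.\<close>

lemma two_cycle_above_threshold: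
  fixes a b c s :: real
  assumes "0 \<le> b" "b < a" "2 \<le> d"
    and a: "a = s - c * b ^ d" and b: "b = s - c * a ^ d"
  shows "(real d + 1) ^ (d - 1) / real d ^ d < c * s ^ (d - 1)"
proof -
  define e where "e = d - 1"
  have d: "d = Suc e" "1 \<le> e" using assms(1-3) by (auto simp: e_def)
  let ?m = "unif_moment a b"
  define D where "D = a ^ d - b ^ d"
  have sa: "c * b ^ d = s - a" and sb: "c * a ^ d = s - b" using a b by linarith+
  have cD: "c * D = a - b" unfolding D_def right_diff_distrib sa sb by simp
  have "s * D = (a + c * b ^ d) * D" unfolding sa by simp
  also have "\<dots> = a * D + b ^ d * (c * D)" by (simp add: algebra_simps)
  also have "\<dots> = a ^ (d + 1) - b ^ (d + 1)" unfolding cD by (simp add: D_def algebra_simps)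
  finally have sD: "s * D = a ^ (d + 1) - b ^ (d + 1)" .
  have m1: "real d * (a - b) * ?m e = D"
    using assms(1-3) d by (simp add: unif_moment_def D_def add.commute)
  have m2: "(real d + 1) * (a - b) * ?m d = s * D"
    using assms(1-3) by (simp add: unif_moment_def sD)
  have mpos: "?m e > 0" using unif_moment_pos assms(1,2) by auto
  have ab: "a - b > 0" using assms(1-3) by simp
  have c: "c = 1 / (real d * ?m e)"
  proof -
    have "(a - b) * (c * (real d * ?m e)) = (a - b) * 1"
      using cD unfolding m1[symmetric] by (simp add: mult_ac)
    hence "c * (real d * ?m e) = 1" using ab by simp
    thus ?thesis using mpos d by (simp add: eq_divide_eq)
  qed
  have s: "s = (real d + 1) * ?m d / (real d * ?m e)"
  proof -
    have "s * (real d * (a - b) * ?m e) = (real d + 1) * (a - b) * ?m d"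
      using m1 m2 by simp
    hence "(a - b) * (s * (real d * ?m e)) = (a - b) * ((real d + 1) * ?m d)"
      by (simp add: mult_ac)
    hence "s * (real d * ?m e) = (real d + 1) * ?m d" using ab by simp
    thus ?thesis using mpos d by (simp add: eq_divide_eq)
  qed
  have "c * s ^ e = (real d + 1) ^ e * ?m d ^ e / (real d ^ d * ?m e ^ d)"
    unfolding c s d(1) by (simp add: power_divide power_mult_distrib mult_ac)
  also have "\<dots> = (real d + 1) ^ e / real d ^ d * (?m d ^ e / ?m e ^ d)" by simp
  also have "\<dots> > (real d + 1) ^ e / real d ^ d * 1"
  proof (rule mult_strict_left_mono)
    show "1 < ?m d ^ e / ?m e ^ d"
      using unif_moment_power_mean[OF assms(1,2) d(2)] mpos by (simp add: d(1))
  qed (use d in auto)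
  finally show ?thesis by (simp add: e_def)
qed

section \<open>The two extremal iterations\<close>

locale percolation_game =
  fixes d :: nat and p q :: real
  assumes d2: "2 \<le> d" and p0: "0 \<le> p" and q0: "0 \<le> q" and pq: "p + q < 1"
begin

text \<open>\<open>hit t\<close> is the factor contributed by a child whose opposite bit is set with
  probability \<open>t\<close>: the mean of \<open>1 - q\<close> and \<open>p\<close> with weights \<open>1 - t\<close> and \<open>t\<close>.\<close>

definition hit :: "real \<Rightarrow> real" where
  "hit t = 1 - q - (1 - p - q) * t"

definition g :: "real \<Rightarrow> real" where
  "g t = hit t ^ d"

text \<open>The orbits of 1 and 0 under \<open>g\<close>, exchanged at every step because
  \<open>g\<close> is decreasing.\<close>

fun hi lo :: "nat \<Rightarrow> real" where
  "hi 0 = 1"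
| "lo 0 = 0"
| "hi (Suc n) = g (lo n)"
| "lo (Suc n) = g (hi n)"

lemma hit_antimono: "t \<le> t' \<Longrightarrow> hit t' \<le> hit t"
  using pq by (auto simp: hit_def intro!: mult_left_mono)

lemma hit_bounds: "t \<in> {0..1} \<Longrightarrow> hit t \<in> {0..1}"
  using hit_antimono[of t 1] hit_antimono[of 0 t] p0 q0 by (auto simp: hit_def)

lemma g_strict_antimono: "t < t' \<Longrightarrow> t' \<le> 1 \<Longrightarrow> g t' < g t"
  unfolding g_def using hit_antimono[of t' 1] p0 pq d2
  by (intro power_strict_mono) (auto simp: hit_def)

lemma g_antimono: "t \<le> t' \<Longrightarrow> t' \<le> 1 \<Longrightarrow> g t' \<le> g t"
  using g_strict_antimono[of t t'] by (cases "t = t'") auto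

lemma g_bounds: "t \<in> {0..1} \<Longrightarrow> g t \<in> {0..1}"
  using hit_bounds[of t] by (auto simp: g_def intro: power_le_one)

lemma continuous_hit: "isCont hit t"
  unfolding hit_def by (intro continuous_intros)

lemma continuous_g: "isCont g t"
  unfolding g_def by (intro continuous_intros continuous_hit)

lemma lo_hi: "0 \<le> lo n \<and> lo n < hi n \<and> hi n \<le> 1"
proof (induction n)
  case (Suc n)
  thus ?case
    using g_strict_antimono[of "lo n" "hi n"] g_bounds[of "lo n"] g_bounds[of "hi n"] by auto
qed auto

text \<open>The intervals \<open>[lo n, hi n]\<close> are nested: the first is all of
  \<open>[0, 1]\<close>, and the antitone \<open>g\<close> preserves inclusion.\<close>

lemma hi_lo_mono: "hi (Suc n) \<le> hi n \<and> lo n \<le> lo (Suc n)"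
proof (induction n)
  case 0
  show ?case using g_bounds[of 0] g_bounds[of 1] by auto
next
  case (Suc n)
  thus ?case using lo_hi[of n] lo_hi[of "Suc n"] by (auto intro!: g_antimono)
qed

lemma hi_lo_limits:
  obtains x y where "hi \<longlonglongrightarrow> x" "lo \<longlonglongrightarrow> y" "x = g y" "y = g x" "0 \<le> y" "y \<le> x" "x \<le> 1"
proof -
  have mono: "decseq hi" "incseq lo"
    using hi_lo_mono by (auto intro: decseq_SucI incseq_SucI)
  have "0 \<le> hi n" "lo n \<le> 1" for n
    using lo_hi[of n] by auto
  hence bounds: "\<forall>n. 0 \<le> hi n" "\<forall>n. lo n \<le> 1" by auto
  obtain x where x: "hi \<longlonglongrightarrow> x"
    using mono(1) bounds(1) by (rule decseq_convergent)
  obtain y where y: "lo \<longlonglongrightarrow> y"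
    using mono(2) bounds(2) by (rule incseq_convergent)
  note lim = x y
  have "(\<lambda>n. hi (Suc n)) \<longlonglongrightarrow> g y"
    unfolding hi.simps by (rule isCont_tendsto_compose[OF continuous_g lim(2)])
  hence "x = g y"
    by (rule LIMSEQ_unique[OF LIMSEQ_Suc[OF lim(1)]])
  moreover have "(\<lambda>n. lo (Suc n)) \<longlonglongrightarrow> g x"
    unfolding lo.simps by (rule isCont_tendsto_compose[OF continuous_g lim(1)])
  hence "y = g x"
    by (rule LIMSEQ_unique[OF LIMSEQ_Suc[OF lim(2)]])
  moreover have "0 \<le> y"
    by (rule LIMSEQ_le_const[OF lim(2)]) (simp add: lo_hi)
  moreover have "y \<le> x"
    by (rule LIMSEQ_le[OF lim(2,1)]) (simp add: lo_hi less_imp_le)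
  moreover have "x \<le> 1"
    by (rule LIMSEQ_le_const2[OF lim(1)]) (simp add: lo_hi)
  ultimately show ?thesis
    by (rule that[OF lim])
qed

lemma hi_lo_merge:
  assumes "(1 - p - q) * (1 - q) ^ (d - 1) \<le> (real d + 1) ^ (d - 1) / real d ^ d"
  shows "(\<lambda>n. hi n - lo n) \<longlonglongrightarrow> 0"
proof -
  obtain x y where xy: "hi \<longlonglongrightarrow> x" "lo \<longlonglongrightarrow> y" "x = g y" "y = g x" "0 \<le> y" "y \<le> x" "x \<le> 1"
    by (rule hi_lo_limits)
  have "x = y"
  proof (rule ccontr)
    assume "x \<noteq> y"
    hence "y < x" using xy(6) by simp
    hence "(1 - p - q) * y < (1 - p - q) * x" using pq by simp
    hence "hit x < hit y" by (simp add: hit_def)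
    moreover have "0 \<le> hit x" using hit_bounds[of x] xy(5-7) by simp
    \<comment> \<open>The \<open>hit\<close> values form a 2-cycle of
      \<open>t \<mapsto> 1 - q - (1 - p - q) * t ^ d\<close>, with \<open>hit y\<close> the larger
      element.\<close>
    moreover have "hit y = 1 - q - (1 - p - q) * hit x ^ d"
      using xy(4) unfolding hit_def g_def by metis
    moreover have "hit x = 1 - q - (1 - p - q) * hit y ^ d"
      using xy(3) unfolding hit_def g_def by metis
    ultimately show False
      using two_cycle_above_threshold d2 assms by (meson linorder_not_le)
  qed
  thus ?thesis using tendsto_diff[OF xy(1,2)] by simp
qed

text \<open>The conclusion says that \<open>g\<close> has slope below -1 at \<open>x\<close>. With
  \<open>w = (1 - p - q) * hit x ^ (d - 1)\<close> the fixed point equation reads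
  \<open>1 - q = hit x * (1 + w)\<close>, so the parameter expression equals
  \<open>w * (1 + w) ^ (d - 1)\<close>. This is increasing in \<open>w\<close> and meets the
  threshold at \<open>w = 1 / d\<close>.\<close>

lemma fixed_point_repelling:
  assumes "(real d + 1) ^ (d - 1) / real d ^ d < (1 - p - q) * (1 - q) ^ (d - 1)"
    and "x = g x" "x \<in> {0..1}"
  shows "1 < (1 - p - q) * (real d * hit x ^ (d - 1))"
proof (rule ccontr)
  define e where "e = d - 1"
  have d: "d = Suc e" using d2 by (simp add: e_def)
  define c where "c = 1 - p - q"
  define w where "w = c * hit x ^ e"
  assume "\<not> ?thesis"
  hence w: "w \<le> 1 / real d" using d2 by (simp add: w_def c_def e_def field_simps)
  have w0: "0 \<le> w" using hit_bounds[OF assms(3)] pq by (simp add: w_def c_def)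
  have gx: "g x = hit x * hit x ^ e"
    unfolding g_def by (subst d) simp
  have "1 - q = hit x + c * g x"
    using assms(2) by (simp add: hit_def c_def)
  also have "\<dots> = hit x * (1 + w)" using gx by (simp add: w_def algebra_simps)
  finally have "c * (1 - q) ^ e = w * (1 + w) ^ e"
    by (simp add: power_mult_distrib w_def)
  also have "\<dots> \<le> (1 / real d) * (1 + 1 / real d) ^ e"
    using w w0 by (intro mult_mono power_mono) auto
  also have "1 + 1 / real d = (real d + 1) / real d"
    using d2 by (simp add: field_simps)
  also have "1 / real d * ((real d + 1) / real d) ^ e = (real d + 1) ^ e / real d ^ d"
    unfolding d by (simp add: power_divide)
  finally show False using assms(1) by (simp add: c_def e_def)
qed

text \<open>A common limit would be a fixed point of \<open>g\<close>, and a repelling one. The gap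
  would then be eventually nondecreasing, yet it is positive at every step.\<close>

lemma hi_lo_separate:
  assumes "(real d + 1) ^ (d - 1) / real d ^ d < (1 - p - q) * (1 - q) ^ (d - 1)"
  shows "\<not> (\<lambda>n. hi n - lo n) \<longlonglongrightarrow> 0"
proof
  assume merge: "(\<lambda>n. hi n - lo n) \<longlonglongrightarrow> 0"
  obtain x y where xy: "hi \<longlonglongrightarrow> x" "lo \<longlonglongrightarrow> y" "x = g y" "y = g x" "0 \<le> y" "y \<le> x" "x \<le> 1"
    by (rule hi_lo_limits)
  have "x - y = 0"
    using tendsto_diff[OF xy(1,2)] merge by (rule LIMSEQ_unique)
  hence yx: "y = x" by simp
  \<comment> \<open>Minus the secant slope of \<open>g\<close> between \<open>lo n\<close> and
    \<open>hi n\<close>, in factored form; its limit is minus the derivative of \<open>g\<close> at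
    \<open>x\<close>.\<close>
  define R where "R n = (1 - p - q) * (\<Sum>i<d. hit (hi n) ^ (d - Suc i) * hit (lo n) ^ i)" for n
  have step: "hi (Suc n) - lo (Suc n) = R n * (hi n - lo n)" for n
  proof -
    have "hi (Suc n) - lo (Suc n) = (hit (lo n) - hit (hi n)) *
        (\<Sum>i<d. hit (hi n) ^ (d - Suc i) * hit (lo n) ^ i)"
      by (simp add: g_def power_diff_sumr2)
    also have "hit (lo n) - hit (hi n) = (1 - p - q) * (hi n - lo n)"
      by (simp add: hit_def algebra_simps)
    finally show ?thesis by (simp add: R_def)
  qed
  have lim_hit: "(\<lambda>n. hit (hi n)) \<longlonglongrightarrow> hit x" "(\<lambda>n. hit (lo n)) \<longlonglongrightarrow> hit x"
    by (rule isCont_tendsto_compose[OF continuous_hit xy(1)],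
        rule isCont_tendsto_compose[OF continuous_hit xy(2)[unfolded yx]])
  have "R \<longlonglongrightarrow> (1 - p - q) * (\<Sum>i<d. hit x ^ (d - Suc i) * hit x ^ i)"
    unfolding R_def by (intro tendsto_intros lim_hit)
  also have "(\<Sum>i<d. hit x ^ (d - Suc i) * hit x ^ i) = (\<Sum>i<d. hit x ^ (d - 1))"
    by (intro sum.cong) (auto simp flip: power_add)
  finally have "R \<longlonglongrightarrow> (1 - p - q) * (real d * hit x ^ (d - 1))" by simp
  moreover have "1 < (1 - p - q) * (real d * hit x ^ (d - 1))"
  proof (rule fixed_point_repelling[OF assms])
    show "x = g x" using xy(3) unfolding yx .
    show "x \<in> {0..1}" using xy(5-7) by simp
  qed
  ultimately have "eventually (\<lambda>n. 1 < R n) sequentially"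
    by (simp add: order_tendsto_iff)
  then obtain N where N: "\<And>n. n \<ge> N \<Longrightarrow> 1 < R n"
    by (auto simp: eventually_sequentially)
  have "hi N - lo N \<le> hi n - lo n" if "n \<ge> N" for n
    using that
  proof (induction n rule: dec_induct)
    case (step n)
    have "1 * (hi n - lo n) \<le> R n * (hi n - lo n)"
      using N[OF step(1)] lo_hi[of n] by (intro mult_right_mono) auto
    thus ?case using step.IH \<open>hi (Suc n) - lo (Suc n) = R n * (hi n - lo n)\<close> by simp
  qed simp
  hence "hi N - lo N \<le> 0"
    by (intro LIMSEQ_le_const[OF merge]) auto
  thus False using lo_hi[of N] by simp
qed

lemma funpow_g_hi_lo:
  "(g ^^ n) 0 = (if even n then lo n else hi n)" "(g ^^ n) 1 = (if even n then hi n else lo n)"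
  by (induction n) auto

end

section \<open>Multiaffine functionals of independent states\<close>

text \<open>Affine in each coordinate of \<open>A\<close> separately, expressed as interpolation
  between the values at 0 and 1.\<close>

definition multiaffine_on :: "'i set \<Rightarrow> (('i \<Rightarrow> real) \<Rightarrow> real) \<Rightarrow> bool" where
  "multiaffine_on A F \<longleftrightarrow>
     (\<forall>u\<in>A. \<forall>m t. F (m(u := t)) = (1 - t) * F (m(u := 0)) + t * F (m(u := 1)))"

lemma expectation_bind_pmf_finite:
  fixes h :: "'b \<Rightarrow> real"
  assumes "finite (set_pmf P)" "\<And>x. finite (set_pmf (f x))"
  shows "measure_pmf.expectation (bind_pmf P f) h =
    measure_pmf.expectation P (\<lambda>x. measure_pmf.expectation (f x) h)"
proof -
  have "measure_pmf.expectation (bind_pmf P f) h =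
      (\<Sum>x\<in>set_pmf P. pmf P x * measure_pmf.expectation (f x) h)"
    using assms by (simp add: pmf_expectation_bind[where A = "set_pmf P"])
  also have "\<dots> = measure_pmf.expectation P (\<lambda>x. measure_pmf.expectation (f x) h)"
    using assms(1) by (simp add: integral_measure_pmf[where A = "set_pmf P"])
  finally show ?thesis .
qed

lemma finite_set_Pi_pmf:
  fixes \<nu> :: "'i \<Rightarrow> 's::finite pmf"
  assumes "finite A"
  shows "finite (set_pmf (Pi_pmf A dflt \<nu>))"
  using assms by (simp add: set_Pi_pmf finite_PiE_dflt)

text \<open>By independence the coordinates can be averaged one at a time, and averaging an affine
  function evaluates it at the mean. Outside \<open>A\<close> the configuration is constantly
  \<open>dflt\<close>.\<close>

lemma expectation_Pi_pmf_multiaffine: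
  fixes f :: "'s::finite \<Rightarrow> real"
  assumes "finite A" "multiaffine_on A F"
  shows "measure_pmf.expectation (Pi_pmf A dflt \<nu>) (\<lambda>w. F (\<lambda>u. f (w u))) =
    F (\<lambda>u. if u \<in> A then measure_pmf.expectation (\<nu> u) f else f dflt)"
  using assms
proof (induction A arbitrary: F rule: finite_induct)
  case empty
  thus ?case by simp
next
  case (insert x A)
  define E where "E = measure_pmf.expectation (\<nu> x) f"
  have int: "integrable (measure_pmf M) h" for M :: "'s pmf" and h :: "'s \<Rightarrow> real"
    by (rule integrable_measure_pmf_finite) simp
  have fin: "finite (set_pmf (Pi_pmf A dflt \<nu>))"
    using insert.hyps by (intro finite_set_Pi_pmf)
  have aff: "F (m(x := t)) = F (m(x := 0)) + t * (F (m(x := 1)) - F (m(x := 0)))" for m t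
    unfolding insert.prems[unfolded multiaffine_on_def, rule_format, OF insertI1, of m t]
    by (simp add: algebra_simps)
  have inner: "measure_pmf.expectation (\<nu> x) (\<lambda>y. F (m(x := f y))) = F (m(x := E))" for m
  proof -
    have "measure_pmf.expectation (\<nu> x) (\<lambda>y. F (m(x := f y))) =
        measure_pmf.expectation (\<nu> x)
          (\<lambda>y. F (m(x := 0)) + f y * (F (m(x := 1)) - F (m(x := 0))))"
      by (intro Bochner_Integration.integral_cong refl aff)
    also have "\<dots> = F (m(x := E))"
      unfolding E_def aff[of m "measure_pmf.expectation (\<nu> x) f"]
      by (subst Bochner_Integration.integral_add) (auto intro: int)
    finally show ?thesis .
  qed
  have upd: "(\<lambda>u. f ((w(x := y)) u)) = ((\<lambda>u. f (w u))(x := f y))" for w y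
    by auto
  \<comment> \<open>The induction hypothesis is applied to \<open>F\<close> with coordinate
    \<open>x\<close> frozen at its mean \<open>E\<close>.\<close>
  have IH: "measure_pmf.expectation (Pi_pmf A dflt \<nu>) (\<lambda>w. F ((\<lambda>u. f (w u))(x := E))) =
    F ((\<lambda>u. if u \<in> A then measure_pmf.expectation (\<nu> u) f else f dflt)(x := E))"
  proof (rule insert.IH)
    show "multiaffine_on A (\<lambda>m. F (m(x := E)))"
      unfolding multiaffine_on_def
    proof (intro ballI allI)
      fix u m t
      assume "u \<in> A"
      hence "u \<noteq> x" using insert.hyps by auto
      hence twist: "(m(u := t))(x := E) = (m(x := E))(u := t)" for t
        by (simp add: fun_upd_twist)
      have "u \<in> insert x A" using \<open>u \<in> A\<close> by simp
      thus "F ((m(u := t))(x := E)) = (1 - t) * F ((m(u := 0))(x := E)) + t * F ((m(u := 1))(x := E))"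
        unfolding twist by (rule insert.prems[unfolded multiaffine_on_def, rule_format])
    qed
  qed
  have "measure_pmf.expectation (Pi_pmf (insert x A) dflt \<nu>) (\<lambda>w. F (\<lambda>u. f (w u))) =
    measure_pmf.expectation
      (bind_pmf (Pi_pmf A dflt \<nu>) (\<lambda>w. bind_pmf (\<nu> x) (\<lambda>y. return_pmf (w(x := y)))))
      (\<lambda>w. F (\<lambda>u. f (w u)))"
    unfolding Pi_pmf_insert'[OF insert.hyps] by (subst bind_commute_pmf) (rule refl)
  also have "\<dots> = measure_pmf.expectation (Pi_pmf A dflt \<nu>)
      (\<lambda>w. measure_pmf.expectation (\<nu> x) (\<lambda>y. F ((\<lambda>u. f (w u))(x := f y))))"
    by (simp add: expectation_bind_pmf_finite fin flip: upd)
  also have "\<dots> = F ((\<lambda>u. if u \<in> A then measure_pmf.expectation (\<nu> u) f else f dflt)(x := E))"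
    by (simp only: inner IH)
  also have "((\<lambda>u. if u \<in> A then measure_pmf.expectation (\<nu> u) f else f dflt)(x := E)) =
      (\<lambda>u. if u \<in> insert x A then measure_pmf.expectation (\<nu> u) f else f dflt)"
    by (auto simp: E_def)
  finally show ?case .
qed

section \<open>The law of the root\<close>

text \<open>\<open>state_bit False\<close> is the bit ``not a win'', \<open>state_bit True\<close> the bit ``a loss''.\<close>

definition state_bit :: "bool \<Rightarrow> state \<Rightarrow> real" where
  "state_bit b a = of_bool (a = L \<or> \<not> b \<and> a = D)"

context percolation_game
begin

text \<open>The deepest generation is collapsed first, the order in which \<open>pta_law\<close>
  peels generations off.\<close>

primrec root_value :: "nat \<Rightarrow> (nat list \<Rightarrow> real) \<Rightarrow> real" where
  "root_value 0 m = m []"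
| "root_value (Suc n) m = root_value n (\<lambda>u. \<Prod>k<d. hit (m (u @ [k])))"

lemma level_snoc: "u \<in> level d n \<Longrightarrow> k < d \<Longrightarrow> u @ [k] \<in> level d (Suc n)"
  by (auto simp: level_def)

lemma level_Suc_cases:
  assumes "v \<in> level d (Suc n)"
  obtains u k where "v = u @ [k]" "u \<in> level d n" "k < d"
  using assms by (cases v rule: rev_cases) (auto simp: level_def)

lemma root_value_cong:
  "(\<And>u. u \<in> level d n \<Longrightarrow> m u = m' u) \<Longrightarrow> root_value n m = root_value n m'"
proof (induction n arbitrary: m m')
  case 0
  thus ?case by (simp add: level_def)
next
  case (Suc n)
  show ?case
    unfolding root_value.simps
    by (intro Suc.IH prod.cong refl) (use Suc.prems level_snoc in auto)
qed

text \<open>A vertex enters only the product at its parent, through a single affine factor, so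
  changing it moves one coordinate of the next generation affinely.\<close>

lemma multiaffine_root_value: "multiaffine_on (level d n) (root_value n)"
proof (induction n)
  case 0
  thus ?case by (auto simp: multiaffine_on_def level_def algebra_simps)
next
  case (Suc n)
  show ?case
    unfolding multiaffine_on_def
  proof (intro ballI allI)
    fix v m and t :: real
    assume "v \<in> level d (Suc n)"
    then obtain u k where v: "v = u @ [k]" "u \<in> level d n" "k < d"
      by (rule level_Suc_cases)
    define M where "M = (\<lambda>u. \<Prod>k<d. hit (m (u @ [k])))"
    define r where "r = (\<Prod>j\<in>{..<d} - {k}. hit (m (u @ [j])))"
    have par: "(\<lambda>w. \<Prod>j<d. hit ((m(v := t)) (w @ [j]))) = M(u := hit t * r)" for t
    proof
      fix w
      show "(\<Prod>j<d. hit ((m(v := t)) (w @ [j]))) = (M(u := hit t * r)) w"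
      proof (cases "w = u")
        case True
        have "(\<Prod>j<d. hit ((m(v := t)) (u @ [j]))) =
            hit ((m(v := t)) (u @ [k])) * (\<Prod>j\<in>{..<d} - {k}. hit ((m(v := t)) (u @ [j])))"
          using v by (intro prod.remove) auto
        also have "(\<Prod>j\<in>{..<d} - {k}. hit ((m(v := t)) (u @ [j]))) = r"
          unfolding r_def by (intro prod.cong) (auto simp: v)
        finally show ?thesis using True by (simp add: v)
      qed (simp add: v M_def)
    qed
    have aff: "root_value n (M(u := a)) =
        root_value n (M(u := 0)) + a * (root_value n (M(u := 1)) - root_value n (M(u := 0)))" for a
      unfolding Suc[unfolded multiaffine_on_def, rule_format, OF v(2), of M a]
      by (simp add: algebra_simps)
    show "root_value (Suc n) (m(v := t)) =
        (1 - t) * root_value (Suc n) (m(v := 0)) + t * root_value (Suc n) (m(v := 1))"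
      unfolding root_value.simps par
      apply (subst aff[of "hit t * r"])
      apply (subst aff[of "hit 0 * r"])
      apply (subst aff[of "hit 1 * r"])
      by (simp add: hit_def algebra_simps)
  qed
qed

text \<open>\<open>(g ^^ n) 0\<close> and \<open>(g ^^ n) 1\<close> enclose the value, but change sides with the parity
  of \<open>n\<close>; \<open>lo\<close> and \<open>hi\<close> keep them sorted.\<close>

lemma root_value_bounds:
  assumes "\<And>u. u \<in> level d n \<Longrightarrow> m u \<in> {lo k..hi k}"
  shows "root_value n m \<in> {lo (k + n)..hi (k + n)}"
  using assms
proof (induction n arbitrary: m k)
  case 0
  thus ?case by (auto simp: level_def)
next
  case (Suc n)
  \<comment> \<open>One collapse sends values in \<open>[lo k, hi k]\<close> to values in
    \<open>[lo (Suc k), hi (Suc k)]\<close>; hence the generalization over \<open>k\<close>.\<close>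
  have "root_value n (\<lambda>u. \<Prod>j<d. hit (m (u @ [j]))) \<in> {lo (Suc k + n)..hi (Suc k + n)}"
  proof (rule Suc.IH)
    fix u assume u: "u \<in> level d n"
    have m: "m (u @ [j]) \<in> {lo k..hi k}" if "j < d" for j
      using Suc.prems[OF level_snoc[OF u that]] .
    have nn: "0 \<le> hit (hi k)" using hit_bounds[of "hi k"] lo_hi[of k] by auto
    have hh: "hit (hi k) \<le> hit (m (u @ [j]))" "hit (m (u @ [j])) \<le> hit (lo k)" if "j < d" for j
      using m[OF that] by (auto intro: hit_antimono)
    have "(\<Prod>j<d. hit (hi k)) \<le> (\<Prod>j<d. hit (m (u @ [j])))"
      using hh nn by (intro prod_mono) auto
    moreover have "(\<Prod>j<d. hit (m (u @ [j]))) \<le> (\<Prod>j<d. hit (lo k))"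
      using hh nn by (intro prod_mono) (auto intro: order_trans)
    ultimately show "(\<Prod>j<d. hit (m (u @ [j]))) \<in> {lo (Suc k)..hi (Suc k)}"
      by (simp add: g_def)
  qed
  thus ?case by simp
qed

lemma root_value_const: "root_value n (\<lambda>_. t) = (g ^^ n) t"
  by (induction n arbitrary: t) (auto simp: g_def funpow_swap1)

text \<open>\<open>hit\<close> is \<open>1 - q\<close> at 0 and \<open>p\<close> at 1. In the
  probability of not winning each lost child contributes \<open>p\<close>, in that of losing each
  child that is not a win does: a bit of the parent sees the opposite bit of the children.\<close>

lemma expectation_B_row:
  assumes "length as = d"
  shows "measure_pmf.expectation (embed_pmf (B_matrix d p q as)) (state_bit b) =
    (\<Prod>k<d. hit (state_bit (\<not> b) (as ! k)))"
proof -
  let ?i = "card {k. k < d \<and> as ! k = L}" and ?j = "card {k. k < d \<and> as ! k = D}"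
  have pmf: "pmf (embed_pmf (B_matrix d p q as)) a = B_matrix d p q as a" for a
    by (rule pmf_embed_stochastic[OF stochastic_B_matrix assms]) (use p0 q0 pq in auto)
  have lhs: "measure_pmf.expectation (embed_pmf (B_matrix d p q as)) (state_bit b) =
    (if b then p ^ (?i + ?j) * (1 - q) ^ (d - (?i + ?j)) else p ^ ?i * (1 - q) ^ (d - ?i))"
    by (subst integral_measure_pmf_real[of UNIV])
      (auto simp: pmf UNIV_state state_bit_def B_matrix_def Let_def)
  define S where "S = {k. k < d \<and> (as ! k = L \<or> b \<and> as ! k = D)}"
  have S: "S \<subseteq> {..<d}" "finite S" by (auto simp: S_def)
  have "card S = (if b then ?i + ?j else ?i)"
  proof (cases b)
    case True
    have "S = {k. k < d \<and> as ! k = L} \<union> {k. k < d \<and> as ! k = D}"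
      using True by (auto simp: S_def)
    thus ?thesis using True by (simp add: card_Un_disjoint disjoint_iff)
  qed (simp add: S_def)
  moreover have "(\<Prod>k<d. hit (state_bit (\<not> b) (as ! k))) = p ^ card S * (1 - q) ^ (d - card S)"
  proof -
    have "(\<Prod>k<d. hit (state_bit (\<not> b) (as ! k))) = (\<Prod>k<d. if k \<in> S then p else 1 - q)"
      by (intro prod.cong) (auto simp: hit_def state_bit_def S_def)
    also have "\<dots> = p ^ card ({..<d} \<inter> S) * (1 - q) ^ card ({..<d} - S)"
      by (subst prod.If_cases) (auto simp: Diff_eq)
    also have "{..<d} \<inter> S = S" using S by auto
    also have "card ({..<d} - S) = d - card S" using S by (simp add: card_Diff_subset)
    finally show ?thesis .
  qed
  ultimately show ?thesis using lhs by simp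
qed

text \<open>The bit flips once per generation, so the boundary is read through bit \<open>b\<close>
  for even \<open>n\<close> and through \<open>\<not> b\<close> for odd \<open>n\<close>.\<close>

lemma expectation_pta_law:
  "measure_pmf.expectation (pta_law d (B_matrix d p q) n \<sigma>) (state_bit b) =
    root_value n (\<lambda>u. state_bit (b = even n) (\<sigma> u))"
proof (induction n arbitrary: \<sigma>)
  case 0
  show ?case by simp
next
  case (Suc n)
  let ?\<nu> = "\<lambda>u. embed_pmf (B_matrix d p q (child_states d \<sigma> u))"
  let ?b = "b = even n"
  have "finite (set_pmf (pta_step d (B_matrix d p q) n \<sigma>))"
    unfolding pta_step_def by (intro finite_set_Pi_pmf finite_level)
  hence "measure_pmf.expectation (pta_law d (B_matrix d p q) (Suc n) \<sigma>) (state_bit b) =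
    measure_pmf.expectation (pta_step d (B_matrix d p q) n \<sigma>)
      (\<lambda>\<omega>. measure_pmf.expectation (pta_law d (B_matrix d p q) n \<omega>) (state_bit b))"
    by (simp add: expectation_bind_pmf_finite)
  also have "\<dots> = measure_pmf.expectation (Pi_pmf (level d n) undefined ?\<nu>)
      (\<lambda>\<omega>. root_value n (\<lambda>u. state_bit ?b (\<omega> u)))"
    by (simp add: Suc.IH pta_step_def)
  also have "\<dots> = root_value n
      (\<lambda>u. if u \<in> level d n then measure_pmf.expectation (?\<nu> u) (state_bit ?b)
        else state_bit ?b undefined)"
    by (intro expectation_Pi_pmf_multiaffine finite_level multiaffine_root_value)
  \<comment> \<open>\<open>root_value n\<close> reads generation \<open>n\<close> only, so the
    branch for the default value disappears.\<close>
  also have "\<dots> = root_value n (\<lambda>u. \<Prod>k<d. hit (state_bit (\<not> ?b) (\<sigma> (u @ [k]))))"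
    by (intro root_value_cong) (simp add: expectation_B_row child_states_def)
  also have "\<dots> = root_value (Suc n) (\<lambda>u. state_bit (b = even (Suc n)) (\<sigma> u))"
    by simp
  finally show ?case .
qed

lemma expectation_pta_law_bounds:
  "measure_pmf.expectation (pta_law d (B_matrix d p q) n \<sigma>) (state_bit b) \<in> {lo n..hi n}"
  unfolding expectation_pta_law using root_value_bounds[of n _ 0]
  by (simp add: state_bit_def)

end

section \<open>Total variation distance\<close>

lemma expectation_state_bit:
  "measure_pmf.expectation P (state_bit b) = pmf P L + of_bool (\<not> b) * pmf P D"
  by (subst integral_measure_pmf_real[of UNIV]) (auto simp: UNIV_state state_bit_def)

lemma tv_dist_ge: "\<bar>measure_pmf.prob P E - measure_pmf.prob Q E\<bar> \<le> tv_dist P Q"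
  unfolding tv_dist_def
proof (rule cSUP_upper)
  have "\<bar>measure_pmf.prob P E - measure_pmf.prob Q E\<bar> \<le> 1" for E
    using measure_pmf.prob_le_1[of P E] measure_pmf.prob_le_1[of Q E]
      measure_nonneg[of P E] measure_nonneg[of Q E] by linarith
  thus "bdd_above (range (\<lambda>E. \<bar>measure_pmf.prob P E - measure_pmf.prob Q E\<bar>))"
    by (intro bdd_aboveI[of _ 1]) auto
qed simp

lemma tv_dist_ge_state_bit:
  "\<bar>measure_pmf.expectation P (state_bit b) - measure_pmf.expectation Q (state_bit b)\<bar>
    \<le> tv_dist P Q"
proof -
  have "measure_pmf.expectation P (state_bit b) =
      measure_pmf.prob P (if b then {L} else {L, D})" for P
    by (simp add: expectation_state_bit measure_measure_pmf_finite)
  thus ?thesis using tv_dist_ge by metis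
qed

text \<open>The two bits determine the law: the masses of \<open>L\<close>, \<open>D\<close> and
  \<open>W\<close> differ by at most \<open>e\<close>, \<open>2 * e\<close> and
  \<open>e\<close>.\<close>

lemma tv_dist_le_state_bits:
  assumes "\<And>b. \<bar>measure_pmf.expectation P (state_bit b) - measure_pmf.expectation Q (state_bit b)\<bar> \<le> e"
  shows "tv_dist P Q \<le> 4 * e"
  unfolding tv_dist_def
proof (rule cSUP_least)
  fix E :: "state set"
  have "pmf P W + pmf P L + pmf P D = 1" for P
    using sum_pmf_eq_1[OF finite subset_UNIV, of P] unfolding UNIV_state by simp
  from this[of P] this[of Q]
  have *: "\<bar>pmf P W - pmf Q W\<bar> + \<bar>pmf P L - pmf Q L\<bar> + \<bar>pmf P D - pmf Q D\<bar> \<le> 4 * e"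
    using assms[of True] assms[of False] by (simp add: expectation_state_bit)
  have "\<bar>measure_pmf.prob P E - measure_pmf.prob Q E\<bar> = \<bar>\<Sum>a\<in>E. pmf P a - pmf Q a\<bar>"
    by (simp add: measure_measure_pmf_finite sum_subtractf)
  also have "\<dots> \<le> (\<Sum>a\<in>E. \<bar>pmf P a - pmf Q a\<bar>)" by (rule sum_abs)
  also have "\<dots> \<le> (\<Sum>a\<in>UNIV. \<bar>pmf P a - pmf Q a\<bar>)" by (intro sum_mono2) auto
  also have "\<dots> \<le> 4 * e" using * by (simp add: UNIV_state)
  finally show "\<bar>measure_pmf.prob P E - measure_pmf.prob Q E\<bar> \<le> 4 * e" .
qed simp

section \<open>Ergodicity as merging of the extremal iterations\<close>

context percolation_game
begin

lemma tv_dist_le_hi_lo: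
  "tv_dist (pta_law d (B_matrix d p q) n \<sigma>) (pta_law d (B_matrix d p q) n \<tau>) \<le> 4 * (hi n - lo n)"
proof (rule tv_dist_le_state_bits)
  fix b
  show "\<bar>measure_pmf.expectation (pta_law d (B_matrix d p q) n \<sigma>) (state_bit b) -
      measure_pmf.expectation (pta_law d (B_matrix d p q) n \<tau>) (state_bit b)\<bar> \<le> hi n - lo n"
    using expectation_pta_law_bounds[of n \<sigma> b] expectation_pta_law_bounds[of n \<tau> b] by auto
qed

text \<open>The constant boundaries \<open>D\<close> and \<open>W\<close> have bit
  \<open>state_bit False\<close> equal to 1 and 0 throughout, so the extremal orbits are
  attained.\<close>

lemma tv_dist_ge_hi_lo:
  obtains \<sigma> \<tau> where "\<sigma> \<in> level d n \<rightarrow>\<^sub>E UNIV" "\<tau> \<in> level d n \<rightarrow>\<^sub>E UNIV"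
    "hi n - lo n \<le> tv_dist (pta_law d (B_matrix d p q) n \<sigma>) (pta_law d (B_matrix d p q) n \<tau>)"
proof -
  define \<sigma> where "\<sigma> a = restrict (\<lambda>_. a) (level d n)" for a :: state
  \<comment> \<open>With this root bit, the boundary is read through \<open>state_bit False\<close>
    whatever the parity of \<open>n\<close>.\<close>
  let ?b = "odd n"
  have root: "measure_pmf.expectation (pta_law d (B_matrix d p q) n (\<sigma> a)) (state_bit ?b) =
      (g ^^ n) (state_bit False a)" for a
  proof -
    have "measure_pmf.expectation (pta_law d (B_matrix d p q) n (\<sigma> a)) (state_bit ?b) =
        root_value n (\<lambda>_. state_bit False a)"
      unfolding expectation_pta_law by (intro root_value_cong) (simp add: \<sigma>_def)
    thus ?thesis by (simp add: root_value_const)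
  qed
  have "\<bar>(g ^^ n) (state_bit False D) - (g ^^ n) (state_bit False W)\<bar>
      \<le> tv_dist (pta_law d (B_matrix d p q) n (\<sigma> D)) (pta_law d (B_matrix d p q) n (\<sigma> W))"
    using tv_dist_ge_state_bit[of "pta_law d (B_matrix d p q) n (\<sigma> D)" ?b
        "pta_law d (B_matrix d p q) n (\<sigma> W)"] unfolding root .
  moreover have "\<bar>(g ^^ n) (state_bit False D) - (g ^^ n) (state_bit False W)\<bar> = hi n - lo n"
    using lo_hi[of n] by (auto simp: state_bit_def funpow_g_hi_lo)
  ultimately show ?thesis
    by (intro that[of "\<sigma> D" "\<sigma> W"]) (auto simp: \<sigma>_def)
qed

text \<open>The supremum of the distances lies between the gap \<open>hi n - lo n\<close> and four
  times that gap.\<close>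

lemma ergodic_iff_hi_lo_merge:
  "pta_ergodic d (B_matrix d p q) \<longleftrightarrow> (\<lambda>n. hi n - lo n) \<longlonglongrightarrow> 0"
proof -
  define T where "T n = (SUP \<sigma>\<in>level d n \<rightarrow>\<^sub>E UNIV. SUP \<tau>\<in>level d n \<rightarrow>\<^sub>E UNIV.
    ereal (tv_dist (pta_law d (B_matrix d p q) n \<sigma>) (pta_law d (B_matrix d p q) n \<tau>)))" for n
  have erg: "pta_ergodic d (B_matrix d p q) \<longleftrightarrow> limsup T = 0"
    unfolding pta_ergodic_def T_def by simp
  have upper: "T n \<le> ereal (4 * (hi n - lo n))" for n
    unfolding T_def by (intro SUP_least) (simp only: ereal_less_eq tv_dist_le_hi_lo)
  have lower: "ereal (hi n - lo n) \<le> T n" for n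
  proof -
    obtain \<sigma> \<tau> where st: "\<sigma> \<in> level d n \<rightarrow>\<^sub>E UNIV" "\<tau> \<in> level d n \<rightarrow>\<^sub>E UNIV"
      "hi n - lo n \<le> tv_dist (pta_law d (B_matrix d p q) n \<sigma>) (pta_law d (B_matrix d p q) n \<tau>)"
      by (rule tv_dist_ge_hi_lo)
    show ?thesis
      unfolding T_def by (rule SUP_upper2[OF st(1)], rule SUP_upper2[OF st(2)]) (use st(3) in simp)
  qed
  show ?thesis
  proof
    assume "pta_ergodic d (B_matrix d p q)"
    hence "limsup T = 0" by (simp add: erg)
    hence "limsup (\<lambda>n. ereal (hi n - lo n)) \<le> 0"
      using Limsup_mono[of "\<lambda>n. ereal (hi n - lo n)" T sequentially] lower by simp
    moreover have "0 \<le> liminf (\<lambda>n. ereal (hi n - lo n))"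
      using lo_hi by (intro Liminf_bounded) (auto intro!: always_eventually simp: less_imp_le)
    ultimately show "(\<lambda>n. hi n - lo n) \<longlonglongrightarrow> 0"
      using limsup_le_liminf_real[of "\<lambda>n. hi n - lo n" 0] by (simp add: zero_ereal_def)
  next
    assume lim: "(\<lambda>n. hi n - lo n) \<longlonglongrightarrow> 0"
    have "T \<longlonglongrightarrow> 0"
    proof (rule tendsto_sandwich)
      show "(\<lambda>n. ereal (hi n - lo n)) \<longlonglongrightarrow> 0"
        using lim by (simp add: zero_ereal_def)
      show "(\<lambda>n. ereal (4 * (hi n - lo n))) \<longlonglongrightarrow> 0"
        using tendsto_mult_left[OF lim, of 4] by (simp add: zero_ereal_def del: times_ereal.simps)
    qed (use lower upper in auto)
    thus "pta_ergodic d (B_matrix d p q)"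
      unfolding erg by (intro lim_imp_Limsup) auto
  qed
qed

end

theorem mainTheorem9:
  fixes d :: nat and p q :: real
  assumes "d \<ge> 2"
    and "p \<in> {0..1}" and "q \<in> {0..1}"
    and "0 < p + q" and "p + q < 1"
  shows "pta_ergodic d (B_matrix d p q) \<longleftrightarrow>
    (1 - p - q) * (1 - q) ^ (d - 1) \<le> (real d + 1) ^ (d - 1) / real d ^ d"
proof -
  interpret percolation_game d p q
    using assms by unfold_locales auto
  show ?thesis
    using ergodic_iff_hi_lo_merge hi_lo_merge hi_lo_separate by (meson linorder_not_le)
qed

end
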